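(* There is an absolute constant $c>0$ such that the following holds for every integer $N\ge 1$. Let $\Sigma_N$ be a set of $N$ equidistributed unit vectors in $\mathbb{R}^2$ and define $$T_N^{*}f(x,y):=\sup_{v\in\Sigma_N}\Big|\lim_{\epsilon\to 0}\int_{|t|>\epsilon}f((x,y)+tv)\,\frac{dt}{t}\Big|.$$ Then the operator norm of $T_N^*$ on $L^2(\mathbb{R}^2)$ satisfies $$\|T_N^{*}\|_{L^2(\mathbb{R}^2)\to L^2(\mathbb{R}^2)}\ge c\,\log N.$$
   Context: A set of $N$ equidistributed unit vectors means $N$ equally spaced points on the unit circle, i.e. $\{(\cos(\theta_0+2\pi j/N),\sin(\theta_0+2\pi j/N)): 0\le j<N\}$ for some $\theta_0\in\mathbb{R}$. The operator norm is $\|T_N^*\|_{L^2\to L^2}=\sup\{\|T_N^*f\|_2: \|f\|_2\le 1\}$; for $f\in L^2(\mathbb{R}^2)$ the limits are taken for almost every $(x,y)$. *)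

theory Defs
  imports "HOL-Analysis.Analysis"
begin

definition equidistributed :: "nat \<Rightarrow> (real \<times> real) set \<Rightarrow> bool" where
  "equidistributed N S \<longleftrightarrow>
     (\<exists>\<theta>::real. S = (\<lambda>j. (cos (\<theta> + 2 * pi * real j / real N),
                           sin (\<theta> + 2 * pi * real j / real N))) ` {..<N})"

(* The L^2 norm with values in [0, \<infinity>]; the case split only extends the square root to \<infinity>. *)
definition L2_norm :: "(real \<times> real \<Rightarrow> 'b::real_normed_vector) \<Rightarrow> ennreal" where
  "L2_norm f =
     (let I = (\<integral>\<^sup>+ p. ennreal ((norm (f p))\<^sup>2) \<partial>lebesgue)
      in if I = \<infinity> then \<infinity> else ennreal (sqrt (enn2real I)))"

(* For f in L^2 and a fixed direction v, the integrals and the limit below exist for almost every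
   p. On the remaining null set the library's total operators return unspecified values, which
   do not affect L^2 norms. *)
definition directional_hilbert ::
    "real \<times> real \<Rightarrow> (real \<times> real \<Rightarrow> complex) \<Rightarrow> real \<times> real \<Rightarrow> complex" where
  "directional_hilbert v f p =
     Lim (at_right 0)
       (\<lambda>\<epsilon>::real. LINT t:{t. \<bar>t\<bar> > \<epsilon>}|lebesgue. f (p + t *\<^sub>R v) / complex_of_real t)"

definition maximal_hilbert ::
    "(real \<times> real) set \<Rightarrow> (real \<times> real \<Rightarrow> complex) \<Rightarrow> real \<times> real \<Rightarrow> real" where
  "maximal_hilbert S f p = (SUP v\<in>S. cmod (directional_hilbert v f p))"

definition L2_operator_norm ::
    "((real \<times> real \<Rightarrow> complex) \<Rightarrow> real \<times> real \<Rightarrow> real) \<Rightarrow> ennreal" where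
  "L2_operator_norm T =
     (SUP f\<in>{f. f \<in> borel_measurable lebesgue \<and> L2_norm f \<le> 1}. L2_norm (T f))"

end

theory Submission
  imports Defs
begin

text \<open>
  The test function is a step version of \<open>1 / \<bar>q\<bar>\<close> on \<open>1 \<le> \<bar>q\<bar> < 2\<^sup>K\<close>, with \<open>2 ^ (2 K)\<close> comparable
  to \<open>N\<close>; the square of its \<open>L\<^sup>2\<close> norm is of order \<open>K\<close>. If \<open>2 ^ (K + 1) \<le> \<bar>p\<bar> < 2 ^ (2 K + 1)\<close>, some
  direction \<open>v\<close> of the set makes the line through \<open>p\<close> pass within \<open>1 / 4\<close> of the origin. On this line
  each of the \<open>K\<close> dyadic scales contributes a constant to the integral of the test function, and
  the kernel \<open>1 / t\<close> has constant sign and size about \<open>1 / \<bar>p\<bar>\<close> there, so the maximal function is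
  at least of order \<open>K / \<bar>p\<bar>\<close>. The square of the \<open>L\<^sup>2\<close> norm of that lower bound over the annulus is of
  order \<open>K\<^sup>3\<close>, so the operator norm is at least of order \<open>K\<close>. Since \<open>p\<close> stays away from the support
  of the test function, the principal value is an ordinary integral.
  For bounded \<open>N\<close> a single scale and a single direction \<open>v\<close>, with \<open>p\<close> near \<open>- 4 v\<close>, suffice.
\<close>

section \<open>Dyadic annuli and the test function\<close>

definition dyadic_annulus :: "nat \<Rightarrow> (real \<times> real) set" where
  "dyadic_annulus k = {q. 2 ^ k \<le> norm q \<and> norm q < 2 ^ Suc k}"

text \<open>Between 1 / |q| and 2 / |q| on its support; being constant on each annulus, it turns the
  integrals into finite sums of measures.\<close>

definition dyadic_profile :: "nat \<Rightarrow> real \<times> real \<Rightarrow> real" where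
  "dyadic_profile K q = (\<Sum>k<K. indicator (dyadic_annulus k) q / 2 ^ k)"

lemma dyadic_annulus_eq_Diff: "dyadic_annulus k = ball 0 (2 ^ Suc k) - ball 0 (2 ^ k)"
  by (auto simp: dyadic_annulus_def)

lemma dyadic_annulus_borel [measurable, simp]: "dyadic_annulus k \<in> sets borel"
  unfolding dyadic_annulus_eq_Diff by auto

lemma emeasure_ball_plane:
  fixes x :: "real \<times> real"
  assumes "r \<ge> 0"
  shows "emeasure lborel (ball x r) = ennreal (pi * r\<^sup>2)"
  using emeasure_ball[OF assms, of x] by (simp add: unit_ball_vol_2 power2_eq_square)

lemma emeasure_dyadic_annulus: "emeasure lborel (dyadic_annulus k) = ennreal (3 * pi * 4 ^ k)"
proof -
  have "ball 0 (2 ^ k) \<subseteq> (ball 0 (2 ^ Suc k) :: (real \<times> real) set)"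
    by (rule subset_ball) simp
  then have "emeasure lborel (dyadic_annulus k) =
      ennreal (pi * (2 ^ Suc k)\<^sup>2) - ennreal (pi * (2 ^ k)\<^sup>2)"
    unfolding dyadic_annulus_eq_Diff
    by (subst emeasure_Diff) (simp_all add: emeasure_ball_plane)
  also have "\<dots> = ennreal (pi * (2 ^ Suc k)\<^sup>2 - pi * (2 ^ k)\<^sup>2)"
    by (rule ennreal_minus) simp
  also have "pi * (2 ^ Suc k)\<^sup>2 - pi * (2 ^ k)\<^sup>2 = 3 * pi * 4 ^ k"
    by (simp add: power_mult_distrib power2_eq_square flip: power_mult_distrib)
  finally show ?thesis .
qed

text \<open>Common evaluation for the squared test function and for the minorants \<open>h\<close>
  below, all of which are step functions on annuli or balls.\<close>

lemma nn_integral_sum_indicator_lebesgue: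
  fixes A :: "'i \<Rightarrow> 'a::euclidean_space set"
  assumes c: "\<And>i. i \<in> I \<Longrightarrow> c i \<ge> 0" and A: "\<And>i. i \<in> I \<Longrightarrow> A i \<in> sets borel"
  shows "(\<integral>\<^sup>+ x. ennreal (\<Sum>i\<in>I. c i * indicator (A i) x) \<partial>lebesgue) =
    (\<Sum>i\<in>I. ennreal (c i) * emeasure lborel (A i))"
proof -
  have "(\<integral>\<^sup>+ x. ennreal (\<Sum>i\<in>I. c i * indicator (A i) x) \<partial>lebesgue) =
      (\<integral>\<^sup>+ x. (\<Sum>i\<in>I. ennreal (c i) * indicator (A i) x) \<partial>lebesgue)"
  proof (intro nn_integral_cong)
    fix x
    have "ennreal (\<Sum>i\<in>I. c i * indicator (A i) x) = (\<Sum>i\<in>I. ennreal (c i * indicator (A i) x))"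
      by (intro sum_ennreal[symmetric] mult_nonneg_nonneg c) auto
    also have "\<dots> = (\<Sum>i\<in>I. ennreal (c i) * indicator (A i) x)"
      by (intro sum.cong refl) (simp split: split_indicator)
    finally show "ennreal (\<Sum>i\<in>I. c i * indicator (A i) x) = (\<Sum>i\<in>I. ennreal (c i) * indicator (A i) x)" .
  qed
  also have "\<dots> = (\<Sum>i\<in>I. ennreal (c i) * emeasure lborel (A i))"
    using A by (subst nn_integral_sum) (auto intro!: sum.cong borel_measurable_times_ennreal borel_measurable_indicator
        simp: nn_integral_cmult_indicator)
  finally show ?thesis .
qed

lemma dyadic_annulus_disjoint:
  assumes "q \<in> dyadic_annulus j" "q \<in> dyadic_annulus k"
  shows "j = k"
proof -
  have "\<not> Suc a \<le> b" if "q \<in> dyadic_annulus a" "q \<in> dyadic_annulus b" for a b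
  proof
    assume "Suc a \<le> b"
    then have "(2::real) ^ Suc a \<le> 2 ^ b"
      by (intro power_increasing) auto
    with that show False
      by (auto simp: dyadic_annulus_def)
  qed
  from this[OF assms] this[OF assms(2,1)] show ?thesis
    by linarith
qed

lemma dyadic_profile_nonneg: "dyadic_profile K q \<ge> 0"
  unfolding dyadic_profile_def by (intro sum_nonneg) auto

lemma dyadic_profile_le: "dyadic_profile K q \<le> real K"
proof -
  have "dyadic_profile K q \<le> (\<Sum>k<K. 1)"
    unfolding dyadic_profile_def
    by (intro sum_mono) (auto simp: indicator_def divide_simps)
  then show ?thesis by simp
qed

lemma dyadic_profile_eq_0: "norm q \<ge> 2 ^ K \<Longrightarrow> dyadic_profile K q = 0"
  unfolding dyadic_profile_def
proof (intro sum.neutral ballI)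
  fix k assume q: "norm q \<ge> 2 ^ K" and "k \<in> {..<K}"
  then have "(2::real) ^ Suc k \<le> 2 ^ K"
    by (intro power_increasing) auto
  with q have "q \<notin> dyadic_annulus k"
    by (auto simp: dyadic_annulus_def)
  then show "indicator (dyadic_annulus k) q / 2 ^ k = (0::real)"
    by simp
qed

lemma dyadic_profile_measurable [measurable]: "dyadic_profile K \<in> borel_measurable borel"
  unfolding dyadic_profile_def[abs_def] by measurable

text \<open>The annuli are disjoint, so no cross terms survive: the profile with \<open>K\<close>
  scales vanishes on annulus \<open>K\<close>.\<close>

lemma dyadic_profile_square:
  "(dyadic_profile K q)\<^sup>2 = (\<Sum>k<K. indicator (dyadic_annulus k) q / 4 ^ k)"
proof (induction K)
  case 0
  show ?case by (simp add: dyadic_profile_def)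
next
  case (Suc K)
  have orth: "dyadic_profile K q * indicator (dyadic_annulus K) q = 0"
    by (cases "q \<in> dyadic_annulus K") (auto simp: dyadic_annulus_def dyadic_profile_eq_0)
  have "dyadic_profile (Suc K) q = dyadic_profile K q + indicator (dyadic_annulus K) q / 2 ^ K"
    by (simp add: dyadic_profile_def)
  then have "(dyadic_profile (Suc K) q)\<^sup>2 = (dyadic_profile K q)\<^sup>2 +
      (indicator (dyadic_annulus K) q / 2 ^ K)\<^sup>2 +
      2 * (dyadic_profile K q * indicator (dyadic_annulus K) q) / 2 ^ K"
    by (simp add: power2_sum)
  also have "(indicator (dyadic_annulus K) q / 2 ^ K)\<^sup>2 =
      (indicator (dyadic_annulus K) q / 4 ^ K :: real)"
    by (simp add: indicator_def power2_eq_square flip: power_mult_distrib)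
  finally show ?case
    by (simp add: orth Suc)
qed

text \<open>Every scale contributes the same amount 3 pi, the area 3 pi 4^k times the squared height
  4^(-k).\<close>

lemma nn_integral_dyadic_profile_square:
  "(\<integral>\<^sup>+ q. ennreal ((dyadic_profile K q)\<^sup>2) \<partial>lebesgue) = ennreal (3 * pi * real K)"
proof -
  have "(\<integral>\<^sup>+ q. ennreal ((dyadic_profile K q)\<^sup>2) \<partial>lebesgue) =
      (\<Sum>k<K. ennreal (1 / 4 ^ k) * emeasure lborel (dyadic_annulus k))"
    using nn_integral_sum_indicator_lebesgue[of "{..<K}" "\<lambda>k. 1 / 4 ^ k" dyadic_annulus]
    by (simp add: dyadic_profile_square)
  also have "\<dots> = (\<Sum>k<K. ennreal (3 * pi))"
    by (intro sum.cong) (auto simp: emeasure_dyadic_annulus simp flip: ennreal_mult)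
  also have "\<dots> = ennreal (3 * pi * real K)"
    by (simp add: ennreal_of_nat_eq_real_of_nat mult.commute flip: ennreal_mult)
  finally show ?thesis .
qed

section \<open>The directional Hilbert transform of the test function\<close>

lemma directional_hilbert_eq_integral:
  assumes "\<delta> > 0" and "\<And>t. \<bar>t\<bar> < \<delta> \<Longrightarrow> f (p + t *\<^sub>R v) = 0"
  shows "directional_hilbert v f p = (LINT t|lebesgue. f (p + t *\<^sub>R v) / complex_of_real t)"
proof -
  let ?I = "LINT t|lebesgue. f (p + t *\<^sub>R v) / complex_of_real t"
  \<comment> \<open>For \<open>\<epsilon> < \<delta>\<close> the truncation removes only points
    where the integrand vanishes, so the limit is that of an eventually constant function.\<close>
  have "(LINT t:{t. \<bar>t\<bar> > \<epsilon>}|lebesgue. f (p + t *\<^sub>R v) / complex_of_real t) = ?I"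
    if "0 < \<epsilon>" "\<epsilon> < \<delta>" for \<epsilon>
    unfolding set_lebesgue_integral_def using that assms(2)
    by (intro Bochner_Integration.integral_cong) (auto simp: indicator_def)
  then have "\<forall>\<^sub>F \<epsilon> in at_right 0.
      (LINT t:{t. \<bar>t\<bar> > \<epsilon>}|lebesgue. f (p + t *\<^sub>R v) / complex_of_real t) = ?I"
    using eventually_at_right_less[of 0] eventually_at_right_real[OF assms(1)]
    by (auto elim!: eventually_mono)
  then show ?thesis
    unfolding directional_hilbert_def
    by (intro tendsto_Lim tendsto_eventually) auto
qed

text \<open>Along the line, the distance to the origin is |t - s| up to 1/4. Hence annulus
  \<open>k\<close> contains an interval of length at least 2^k / 2 of the line, on which the profile
  is 2^(-k). As 1 / t is at least 1 / (2 s) on the support, each of the \<open>K\<close> scales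
  contributes at least a / (4 s).\<close>

lemma directional_hilbert_profile_ge:
  fixes v p :: "real \<times> real"
  assumes a: "a \<ge> 0" and v: "norm v = 1"
    and near: "norm (p + s *\<^sub>R v) \<le> 1 / 4" and s: "s \<ge> 2 * 2 ^ K"
  shows "cmod (directional_hilbert v (\<lambda>q. complex_of_real (a * dyadic_profile K q)) p)
    \<ge> a * real K / (4 * s)"
proof -
  define g where "g t = a * dyadic_profile K (p + t *\<^sub>R v) / t" for t
  have K1: "(1::real) \<le> 2 ^ K" by simp
  have s0: "s > 0" using s K1 by linarith
  have dist: "\<bar>norm (p + t *\<^sub>R v) - \<bar>t - s\<bar>\<bar> \<le> 1 / 4" for t
  proof -
    have "\<bar>norm (p + t *\<^sub>R v) - norm ((t - s) *\<^sub>R v)\<bar> \<le> norm ((p + t *\<^sub>R v) - (t - s) *\<^sub>R v)"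
      by (rule norm_triangle_ineq3)
    also have "(p + t *\<^sub>R v) - (t - s) *\<^sub>R v = p + s *\<^sub>R v"
      by (simp add: algebra_simps)
    finally show ?thesis using near v by simp
  qed
  \<comment> \<open>The lower bound keeps the support off the singularity and makes the kernel
    positive; the upper bound gives 1 / t > 1 / (2 s).\<close>
  have supp: "1 / 2 < t \<and> t < 2 * s" if "dyadic_profile K (p + t *\<^sub>R v) \<noteq> 0" for t
  proof -
    have "norm (p + t *\<^sub>R v) < 2 ^ K"
      using that dyadic_profile_eq_0 by (meson not_less)
    with dist[of t] s K1 show ?thesis
      by linarith
  qed
  have g_nonneg: "g t \<ge> 0" for t
    using supp[of t] a dyadic_profile_nonneg[of K "p + t *\<^sub>R v"]
    by (cases "dyadic_profile K (p + t *\<^sub>R v) = 0") (auto simp: g_def)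
  have g_meas [measurable]: "g \<in> borel_measurable borel"
    unfolding g_def[abs_def] by measurable
  \<comment> \<open>A non-integrable function would have integral 0 by convention, so integrability
    precedes the lower bound. Since 1 / t < 2 on the support, a multiple of an interval indicator
    dominates.\<close>
  have g_int: "integrable lborel g"
  proof (rule Bochner_Integration.integrable_bound)
    show "integrable lborel (\<lambda>t. (2 * a * real K) * indicator {0..2 * s} t :: real)"
      by (intro integrable_mult_right integrable_real_indicator) (auto simp: s0 emeasure_lborel_Icc_eq)
    show "AE t in lborel. norm (g t) \<le> norm ((2 * a * real K) * indicator {0..2 * s} t :: real)"
    proof (rule AE_I2)
      fix t
      show "norm (g t) \<le> norm ((2 * a * real K) * indicator {0..2 * s} t :: real)"
      proof (cases "dyadic_profile K (p + t *\<^sub>R v) = 0")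
        case False
        with supp[of t] have t: "1 / 2 < t" "t < 2 * s" by auto
        have "g t \<le> a * real K / t"
          unfolding g_def using t a dyadic_profile_le
          by (intro divide_right_mono mult_left_mono) auto
        also have "\<dots> \<le> a * real K / (1 / 2)"
          using t a by (intro divide_left_mono) auto
        finally show ?thesis using t a g_nonneg[of t] by (auto simp: abs_mult)
      qed (simp add: g_def)
    qed
  qed simp
  \<comment> \<open>The crossing of annulus \<open>k\<close> beyond t = s, trimmed by 1/4 at both
    ends to absorb the error in \<open>dist\<close>.\<close>
  define J where "J k = {s + 2 ^ k + 1 / 4 ..< s + 2 ^ Suc k - 1 / 4}" for k :: nat
  have len: "measure lborel (J k) = 2 ^ k - 1 / 2" for k
  proof -
    have "(1::real) \<le> 2 * 2 ^ k" using one_le_power[of "2::real" k] by linarith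
    then show ?thesis unfolding J_def by (subst measure_lborel_Ico) auto
  qed
  have J_int: "integrable lborel (\<lambda>t. indicator (J k) t :: real)" for k
  proof (intro integrable_real_indicator)
    have "bounded (J k)"
      by (rule bounded_subset[of "{s + 2 ^ k + 1 / 4 .. s + 2 ^ Suc k - 1 / 4}"]) (auto simp: J_def)
    then show "emeasure lborel (J k) < \<infinity>"
      by (rule emeasure_bounded_finite)
  qed (simp add: J_def)
  have J_annulus: "p + t *\<^sub>R v \<in> dyadic_annulus k" if "t \<in> J k" for t k
    using that dist[of t] s0 zero_less_power[of "2::real" k]
    by (auto simp: J_def dyadic_annulus_def abs_if split: if_splits)
  have g_lower: "(\<Sum>k<K. a / (2 * s) / 2 ^ k * indicator (J k) t) \<le> g t" for t
  proof -
    have "(\<Sum>k<K. a / (2 * s) / 2 ^ k * indicator (J k) t) \<le>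
        (\<Sum>k<K. a / (2 * s) / 2 ^ k * indicator (dyadic_annulus k) (p + t *\<^sub>R v))"
      using a s0 J_annulus by (intro sum_mono mult_left_mono) (auto simp: indicator_def)
    also have "\<dots> = a * dyadic_profile K (p + t *\<^sub>R v) / (2 * s)"
      by (simp add: dyadic_profile_def sum_distrib_left sum_divide_distrib field_simps)
    also have "\<dots> \<le> g t"
      unfolding g_def
      using supp[of t] a dyadic_profile_nonneg[of K "p + t *\<^sub>R v"] s0
      by (cases "dyadic_profile K (p + t *\<^sub>R v) = 0") (auto intro!: divide_left_mono)
    finally show ?thesis .
  qed
  have "a * real K / (4 * s) = (\<Sum>k<K. a / (4 * s))"
    by simp
  also have "\<dots> \<le> (\<Sum>k<K. a / (2 * s) / 2 ^ k * measure lborel (J k))"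
  proof (rule sum_mono)
    fix k
    have "a / (4 * s) = a / (2 * s) / 2 ^ k * (2 ^ k / 2)"
      by simp
    also have "\<dots> \<le> a / (2 * s) / 2 ^ k * (2 ^ k - 1 / 2)"
      using a s0 one_le_power[of "2::real" k] by (intro mult_left_mono) auto
    finally show "a / (4 * s) \<le> a / (2 * s) / 2 ^ k * measure lborel (J k)"
      by (simp add: len)
  qed
  also have "\<dots> = (LINT t|lborel. (\<Sum>k<K. a / (2 * s) / 2 ^ k * indicator (J k) t))"
    using J_int by (subst Bochner_Integration.integral_sum) auto
  also have "\<dots> \<le> (LINT t|lborel. g t)"
    using J_int g_lower by (intro integral_mono g_int Bochner_Integration.integrable_sum) auto
  also have "\<dots> \<le> cmod (LINT t|lborel. complex_of_real (g t))"
    by (simp add: integral_complex_of_real)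
  also have "(LINT t|lborel. complex_of_real (g t)) = (LINT t|lebesgue. complex_of_real (g t))"
    by (rule integral_completion[symmetric]) measurable
  also have "\<dots> = directional_hilbert v (\<lambda>q. complex_of_real (a * dyadic_profile K q)) p"
  proof (subst directional_hilbert_eq_integral[of "1 / 2"])
    show "complex_of_real (a * dyadic_profile K (p + t *\<^sub>R v)) = 0" if "\<bar>t\<bar> < 1 / 2" for t
      using supp[of t] that by fastforce
  qed (simp_all add: g_def)
  finally show ?thesis .
qed

section \<open>Approximation by equidistributed directions\<close>

lemma equidistributed_finite: "equidistributed N S \<Longrightarrow> finite S"
  by (auto simp: equidistributed_def)

lemma equidistributed_norm: "equidistributed N S \<Longrightarrow> v \<in> S \<Longrightarrow> norm v = 1"
  by (auto simp: equidistributed_def norm_Pair)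

text \<open>Rounding the angle of \<open>u\<close> down to the grid moves it by at most 2 pi / N.
  Cosine and sine are 1-Lipschitz, so the distance is at most 4 pi / N, below 16 / N.\<close>

lemma equidistributed_dense:
  assumes S: "equidistributed N S" and N: "N \<ge> 1" and u: "norm u = 1"
  shows "\<exists>v\<in>S. norm (u - v) \<le> 16 / real N"
proof -
  obtain \<theta> where \<theta>: "S = (\<lambda>j. (cos (\<theta> + 2 * pi * real j / real N),
                           sin (\<theta> + 2 * pi * real j / real N))) ` {..<N}"
    using S by (auto simp: equidistributed_def)
  have "(fst u)\<^sup>2 + (snd u)\<^sup>2 = 1"
    using u by (metis norm_Pair prod.collapse real_sqrt_eq_1_iff real_norm_def power2_abs)
  then obtain \<alpha> where \<alpha>: "fst u = cos \<alpha>" "snd u = sin \<alpha>"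
    by (metis sincos_total_2pi)
  define m where "m = \<lfloor>(\<alpha> - \<theta>) * real N / (2 * pi)\<rfloor>"
  \<comment> \<open>The rounded index \<open>m\<close> may be any integer; reducing it modulo
    \<open>N\<close> changes the angle by a multiple of 2 pi.\<close>
  define j where "j = nat (m mod int N)"
  define \<beta> where "\<beta> = \<theta> + 2 * pi * of_int m / real N"
  have jN: "j < N"
    using N by (simp add: j_def nat_less_iff)
  have "of_int m = real j + real N * of_int (m div int N)"
  proof -
    have "m = int j + int N * (m div int N)"
      using N by (simp add: j_def)
    then have "real_of_int m = of_int (int j + int N * (m div int N))" by simp
    then show ?thesis by simp
  qed
  then have \<beta>: "\<beta> = \<theta> + 2 * pi * real j / real N + 2 * pi * of_int (m div int N)"
    using N by (simp add: \<beta>_def field_simps)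
  have v: "(cos \<beta>, sin \<beta>) \<in> S"
    using jN unfolding \<theta> \<beta>
    by (intro image_eqI[of _ _ j])
      (auto simp: cos_add sin_add cos_int_2pin sin_int_2pin)
  have "\<bar>(\<alpha> - \<theta>) * real N / (2 * pi) - of_int m\<bar> \<le> 1"
    unfolding m_def by linarith
  then have "\<bar>(\<alpha> - \<theta>) * real N / (2 * pi) - of_int m\<bar> * (2 * pi / real N) \<le> 1 * (2 * pi / real N)"
    by (intro mult_right_mono) auto
  also have "\<bar>(\<alpha> - \<theta>) * real N / (2 * pi) - of_int m\<bar> * (2 * pi / real N) =
      \<bar>((\<alpha> - \<theta>) * real N / (2 * pi) - of_int m) * (2 * pi / real N)\<bar>"
    by (simp add: abs_mult)
  also have "((\<alpha> - \<theta>) * real N / (2 * pi) - of_int m) * (2 * pi / real N) = \<alpha> - \<beta>"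
    using N by (simp add: \<beta>_def field_simps)
  finally have \<alpha>\<beta>: "\<bar>\<alpha> - \<beta>\<bar> \<le> 2 * pi / real N" by simp
  have c: "\<bar>cos \<alpha> - cos \<beta>\<bar> \<le> \<bar>\<alpha> - \<beta>\<bar>"
  proof -
    have "\<bar>cos \<alpha> - cos \<beta>\<bar> = 2 * \<bar>sin ((\<alpha> + \<beta>) / 2)\<bar> * \<bar>sin ((\<beta> - \<alpha>) / 2)\<bar>"
      by (simp add: cos_diff_cos abs_mult)
    also have "\<dots> \<le> 2 * 1 * \<bar>(\<beta> - \<alpha>) / 2\<bar>"
      by (intro mult_mono abs_sin_le_one abs_sin_x_le_abs_x) auto
    finally show ?thesis by simp
  qed
  have s: "\<bar>sin \<alpha> - sin \<beta>\<bar> \<le> \<bar>\<alpha> - \<beta>\<bar>"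
  proof -
    have "\<bar>sin \<alpha> - sin \<beta>\<bar> = 2 * \<bar>sin ((\<alpha> - \<beta>) / 2)\<bar> * \<bar>cos ((\<alpha> + \<beta>) / 2)\<bar>"
      by (simp add: sin_diff_sin abs_mult)
    also have "\<dots> \<le> 2 * \<bar>(\<alpha> - \<beta>) / 2\<bar> * 1"
      by (intro mult_mono abs_cos_le_one abs_sin_x_le_abs_x) auto
    finally show ?thesis by simp
  qed
  have "norm (u - (cos \<beta>, sin \<beta>)) \<le> \<bar>cos \<alpha> - cos \<beta>\<bar> + \<bar>sin \<alpha> - sin \<beta>\<bar>"
    using norm_Pair_le[of "cos \<alpha> - cos \<beta>" "sin \<alpha> - sin \<beta>"] \<alpha> by (cases u) simp
  also have "\<dots> \<le> 2 * (2 * pi / real N)"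
    using c s \<alpha>\<beta> by linarith
  also have "\<dots> \<le> 16 / real N"
    using pi_less_4 N by (simp add: divide_right_mono)
  finally show ?thesis using v by blast
qed

section \<open>From pointwise minorants to the operator norm\<close>

lemma L2_norm_ge:
  assumes "b \<ge> 0" "(\<integral>\<^sup>+ p. ennreal ((norm (f p))\<^sup>2) \<partial>lebesgue) \<ge> ennreal (b\<^sup>2)"
  shows "L2_norm f \<ge> ennreal b"
proof (cases "(\<integral>\<^sup>+ p. ennreal ((norm (f p))\<^sup>2) \<partial>lebesgue)")
  case (real r)
  with assms have "b\<^sup>2 \<le> r" by simp
  then have "b \<le> sqrt r" using real_le_rsqrt by blast
  with real show ?thesis by (simp add: L2_norm_def)
qed (simp add: L2_norm_def)

text \<open>The factor \<open>a\<close> normalises the test function in L^2. The explicit Borel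
  function \<open>h\<close> lies below the square of the maximal function, so monotonicity of the
  integral transfers the bound \<open>int\<close>.\<close>

lemma L2_operator_norm_maximal_hilbert_ge:
  assumes S: "equidistributed N S" and K: "K \<ge> 1" and a: "a = 1 / sqrt (3 * pi * real K)"
    and b: "b \<ge> 0"
    and h: "h \<in> borel_measurable borel" "\<And>p. h p \<ge> 0"
    and le: "\<And>p. h p \<noteq> 0 \<Longrightarrow> \<exists>v\<in>S. \<exists>s. norm (p + s *\<^sub>R v) \<le> 1 / 4 \<and> s \<ge> 2 * 2 ^ K \<and>
        h p \<le> (a * real K / (4 * s))\<^sup>2"
    and int: "ennreal (b\<^sup>2) \<le> (\<integral>\<^sup>+ p. ennreal (h p) \<partial>lebesgue)"
  shows "L2_operator_norm (maximal_hilbert S) \<ge> ennreal b"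
proof -
  define f where "f q = complex_of_real (a * dyadic_profile K q)" for q
  have a0: "a \<ge> 0" unfolding a by simp
  have "f \<in> borel_measurable lborel"
    unfolding f_def[abs_def] by measurable
  then have f_meas: "f \<in> borel_measurable lebesgue"
    by (rule measurable_completion)
  have "(\<integral>\<^sup>+ p. ennreal ((norm (f p))\<^sup>2) \<partial>lebesgue) =
      (\<integral>\<^sup>+ p. ennreal (a\<^sup>2) * ennreal ((dyadic_profile K p)\<^sup>2) \<partial>lebesgue)"
    by (intro nn_integral_cong)
      (simp add: f_def norm_mult power_mult_distrib flip: ennreal_mult)
  also have "\<dots> = ennreal (a\<^sup>2) * ennreal (3 * pi * real K)"
  proof (subst nn_integral_cmult)
    show "(\<lambda>p. ennreal ((dyadic_profile K p)\<^sup>2)) \<in> borel_measurable lebesgue"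
      by (rule measurable_completion) measurable
  qed (simp add: nn_integral_dyadic_profile_square)
  also have "\<dots> = 1"
    using K by (simp add: a power_divide flip: ennreal_mult)
  finally have f_norm: "L2_norm f \<le> 1"
    by (simp add: L2_norm_def)
  have "ennreal (h p) \<le> ennreal ((norm (maximal_hilbert S f p))\<^sup>2)" for p
  proof (cases "h p = 0")
    case False
    with le obtain v s where vs: "v \<in> S" "norm (p + s *\<^sub>R v) \<le> 1 / 4" "s \<ge> 2 * 2 ^ K"
      "h p \<le> (a * real K / (4 * s))\<^sup>2" by blast
    have s0: "s > 0"
      using vs(3) zero_less_power[of "2::real" K] by linarith
    have "a * real K / (4 * s) \<le> cmod (directional_hilbert v f p)"
      unfolding f_def
      using directional_hilbert_profile_ge[OF a0 equidistributed_norm[OF S vs(1)] vs(2,3)] .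
    \<comment> \<open>Finiteness of \<open>S\<close> makes the real supremum one over a bounded set,
      so it dominates each member.\<close>
    also have "\<dots> \<le> maximal_hilbert S f p"
      unfolding maximal_hilbert_def using equidistributed_finite[OF S] vs(1)
      by (intro cSUP_upper) auto
    finally have "(a * real K / (4 * s))\<^sup>2 \<le> (maximal_hilbert S f p)\<^sup>2"
      using a0 s0 by (intro power_mono) auto
    with vs(4) show ?thesis by (intro ennreal_leI) simp
  qed simp
  then have "ennreal (b\<^sup>2) \<le> (\<integral>\<^sup>+ p. ennreal ((norm (maximal_hilbert S f p))\<^sup>2) \<partial>lebesgue)"
    by (intro order_trans[OF int] nn_integral_mono)
  then have "ennreal b \<le> L2_norm (maximal_hilbert S f)"
    by (rule L2_norm_ge[OF b])
  then show ?thesis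
    unfolding L2_operator_norm_def using f_meas f_norm
    by (intro SUP_upper2[of f]) auto
qed

section \<open>Lower bounds for bounded and for large N\<close>

lemma L2_operator_norm_maximal_hilbert_ge_const:
  assumes S: "equidistributed N S" and N: "N \<ge> 1"
  shows "L2_operator_norm (maximal_hilbert S) \<ge> ennreal (1 / 128)"
proof -
  obtain v where v: "v \<in> S"
    using S N by (fastforce simp: equidistributed_def)
  define a where "a = 1 / sqrt (3 * pi * real 1)"
  \<comment> \<open>For K = 1 the smallest admissible \<open>s\<close> is 4, and a K / (4 s) becomes
    a / 16.\<close>
  define h :: "real \<times> real \<Rightarrow> real" where
    "h p = (a / 16)\<^sup>2 * indicator (ball (- 4 *\<^sub>R v) (1 / 4)) p" for p
  show ?thesis
  proof (rule L2_operator_norm_maximal_hilbert_ge[OF S, of 1 a _ h])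
    have "ball (- 4 *\<^sub>R v) (1 / 4) \<in> sets borel" by simp
    then show "h \<in> borel_measurable borel"
      unfolding h_def[abs_def] by (intro borel_measurable_times borel_measurable_indicator) auto
    show "\<exists>v\<in>S. \<exists>s. norm (p + s *\<^sub>R v) \<le> 1 / 4 \<and> s \<ge> 2 * 2 ^ 1 \<and>
        h p \<le> (a * real 1 / (4 * s))\<^sup>2" if "h p \<noteq> 0" for p
    proof (intro bexI[OF _ v] exI[of _ 4] conjI)
      have "dist (- 4 *\<^sub>R v) p < 1 / 4"
        using that by (auto simp: h_def indicator_def split: if_splits)
      moreover have "dist (- 4 *\<^sub>R v) p = norm (p + 4 *\<^sub>R v)"
        by (simp add: dist_norm norm_minus_commute add.commute)
      ultimately show "norm (p + 4 *\<^sub>R v) \<le> 1 / 4" by simp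
    qed (auto simp: h_def indicator_def)
    have "(\<integral>\<^sup>+ p. ennreal (h p) \<partial>lebesgue) =
        ennreal ((a / 16)\<^sup>2) * ennreal (pi * (1 / 4)\<^sup>2)"
      unfolding h_def
      using nn_integral_sum_indicator_lebesgue
        [of "{()}" "\<lambda>_. (a / 16)\<^sup>2" "\<lambda>_. ball (- 4 *\<^sub>R v) (1 / 4)"]
      by (simp add: emeasure_ball_plane)
    \<comment> \<open>As a^2 = 1 / (3 pi), the factor pi cancels and 3 * 256 * 16 = 12288 remains,
      which is less than 128^2.\<close>
    also have "\<dots> = ennreal (1 / 12288)"
      by (simp add: a_def power_divide flip: ennreal_mult)
    finally show "ennreal ((1 / 128)\<^sup>2) \<le> (\<integral>\<^sup>+ p. ennreal (h p) \<partial>lebesgue)"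
      by (simp add: power2_eq_square)
  qed (auto simp: a_def h_def)
qed

text \<open>With s = |p|, the squared bound decays like 1 / |p|^2, so each of the \<open>K\<close>
  annuli with index in \<open>{K<..2 * K}\<close> contributes the same amount K / 64. The total is
  (K / 8)^2.\<close>

lemma L2_operator_norm_maximal_hilbert_ge_scales:
  assumes S: "equidistributed N S" and K: "K \<ge> 1" and N: "2 ^ (2 * K + 7) \<le> N"
  shows "L2_operator_norm (maximal_hilbert S) \<ge> ennreal (real K / 8)"
proof -
  define a where "a = 1 / sqrt (3 * pi * real K)"
  \<comment> \<open>The outer radius of annulus \<open>j\<close> replaces |p|, which makes the
    minorant constant there.\<close>
  define c where "c j = (a * real K / (4 * 2 ^ Suc j))\<^sup>2" for j
  define h :: "real \<times> real \<Rightarrow> real" where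
    "h p = (\<Sum>j\<in>{K<..2 * K}. c j * indicator (dyadic_annulus j) p)" for p
  have N1: "N \<ge> 1" using order_trans[OF _ N, of 1] by simp
  have c0: "c j \<ge> 0" for j by (simp add: c_def)
  show ?thesis
  proof (rule L2_operator_norm_maximal_hilbert_ge[OF S K a_def, of _ h])
    show "h \<in> borel_measurable borel"
      unfolding h_def[abs_def] by measurable
    show "h p \<ge> 0" for p
      unfolding h_def by (intro sum_nonneg mult_nonneg_nonneg c0) auto
    show "\<exists>v\<in>S. \<exists>s. norm (p + s *\<^sub>R v) \<le> 1 / 4 \<and> s \<ge> 2 * 2 ^ K \<and>
        h p \<le> (a * real K / (4 * s))\<^sup>2" if h0: "h p \<noteq> 0" for p
    proof -
      obtain j where j: "K < j" "j \<le> 2 * K" "p \<in> dyadic_annulus j"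
        using h0 unfolding h_def
        by (metis (no_types, lifting) greaterThanAtMost_iff indicator_simps(2) mult_zero_right sum.neutral)
      have "h p = (\<Sum>i\<in>{K<..2 * K}. if i = j then c j else 0)"
        unfolding h_def using j(3)
        by (intro sum.cong) (auto simp: indicator_def dest: dyadic_annulus_disjoint[OF j(3)])
      then have hp: "h p = c j" using j by simp
      define r where "r = norm p"
      have r: "2 ^ j \<le> r" "r < 2 ^ Suc j"
        using j(3) by (auto simp: dyadic_annulus_def r_def)
      have r0: "r > 0" using r(1) zero_less_power[of "2::real" j] by linarith
      \<comment> \<open>The direction is chosen close to the one pointing from \<open>p\<close> to
        the origin, so that travelling a distance \<open>r\<close> ends near 0.\<close>
      have "norm (- (1 / r) *\<^sub>R p) = 1"
        using r0 by (simp add: r_def)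
      then obtain v where v: "v \<in> S" "norm (- (1 / r) *\<^sub>R p - v) \<le> 16 / real N"
        using equidistributed_dense[OF S N1] by blast
      have "p + r *\<^sub>R v = - r *\<^sub>R (- (1 / r) *\<^sub>R p - v)"
        using r0 by (simp add: scaleR_diff_right)
      then have "norm (p + r *\<^sub>R v) = r * norm (- (1 / r) *\<^sub>R p - v)"
        using r0 by (metis norm_scaleR abs_minus_cancel abs_of_pos)
      also have "\<dots> \<le> 2 ^ Suc j * (16 / real N)"
        using v(2) r by (intro mult_mono) auto
      \<comment> \<open>The exponent 2 K + 7 is what this needs: outer radius 2^(2 K + 1), angular
        error 2^4 / N and tolerance 2^(-2).\<close>
      also have "\<dots> \<le> 2 ^ Suc (2 * K) * (16 / 2 ^ (2 * K + 7))"
      proof (intro mult_mono divide_left_mono power_increasing)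
        show "2 ^ (2 * K + 7) \<le> real N"
          using N by (metis of_nat_le_iff of_nat_numeral of_nat_power)
      qed (use j N1 in auto)
      also have "\<dots> = 1 / 4"
        by (simp add: power_add)
      finally have near: "norm (p + r *\<^sub>R v) \<le> 1 / 4" .
      \<comment> \<open>The strict inequality K < j supplies the factor 2.\<close>
      have "2 * 2 ^ K = (2::real) ^ Suc K" by simp
      also have "\<dots> \<le> 2 ^ j" using j by (intro power_increasing) auto
      finally have far: "2 * 2 ^ K \<le> r" using r by simp
      have "h p \<le> (a * real K / (4 * r))\<^sup>2"
        unfolding hp c_def using r r0
        by (intro power_mono divide_left_mono) (auto simp: a_def)
      with near far v(1) show ?thesis by blast
    qed
    have "(\<integral>\<^sup>+ p. ennreal (h p) \<partial>lebesgue) =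
        (\<Sum>j\<in>{K<..2 * K}. ennreal (c j) * emeasure lborel (dyadic_annulus j))"
      unfolding h_def by (intro nn_integral_sum_indicator_lebesgue c0) simp
    also have "\<dots> = (\<Sum>j\<in>{K<..2 * K}. ennreal (real K / 64))"
    proof (intro sum.cong refl)
      fix j
      have four: "(2 ^ j)\<^sup>2 = (4 ^ j :: real)"
        by (simp add: power2_eq_square flip: power_mult_distrib)
      have "c j * (3 * pi * 4 ^ j) = real K / 64"
        using K by (simp add: c_def a_def power_divide power_mult_distrib four)
          (simp add: power2_eq_square)
      then show "ennreal (c j) * emeasure lborel (dyadic_annulus j) = ennreal (real K / 64)"
        by (simp add: emeasure_dyadic_annulus c0 flip: ennreal_mult)
    qed
    also have "\<dots> = ennreal ((real K / 8)\<^sup>2)"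
      by (simp add: ennreal_of_nat_eq_real_of_nat power2_eq_square flip: ennreal_mult)
    finally show "ennreal ((real K / 8)\<^sup>2) \<le> (\<integral>\<^sup>+ p. ennreal (h p) \<partial>lebesgue)"
      by simp
  qed simp
qed

section \<open>The logarithmic lower bound for all N\<close>

theorem proposition3p3:
  shows "\<exists>c::real. c > 0 \<and>
    (\<forall>N::nat. N \<ge> 1 \<longrightarrow>
      (\<forall>S. equidistributed N S \<longrightarrow>
        L2_operator_norm (maximal_hilbert S) \<ge> ennreal (c * ln (real N))))"
proof (intro exI[of _ "1 / 2000"] conjI allI impI)
  fix N :: nat and S
  assume N: "N \<ge> 1" and S: "equidistributed N S"
  have ln_le: "ln (real N) \<le> real m" if "N \<le> 2 ^ m" for m
  proof -
    have "real N \<le> 2 ^ m"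
      using that by (metis of_nat_le_iff of_nat_numeral of_nat_power)
    then have "ln (real N) \<le> ln (2 ^ m)" using N by (subst ln_le_cancel_iff) auto
    also have "\<dots> = real m * ln 2" by (rule ln_realpow)
    also have "\<dots> \<le> real m" using ln_2_less_1 by (simp add: mult_left_le)
    finally show ?thesis .
  qed
  show "ennreal (1 / 2000 * ln (real N)) \<le> L2_operator_norm (maximal_hilbert S)"
  \<comment> \<open>The threshold 2^9 = 2^(2 * 1 + 7) is where a first scale K = 1 becomes
    available. Below it ln N is at most 9, and 9 / 2000 < 1 / 128.\<close>
  proof (cases "N \<le> 2 ^ 9")
    case True
    from ln_le[OF this] have "1 / 2000 * ln (real N) \<le> 1 / 128" by simp
    then show ?thesis
      using L2_operator_norm_maximal_hilbert_ge_const[OF S N] by (meson ennreal_leI order_trans)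
  next
    case False
    define P where "P K \<longleftrightarrow> 2 ^ (2 * K + 7) \<le> N" for K :: nat
    \<comment> \<open>Maximality of \<open>K\<close> bounds \<open>N\<close> by 2^(2 K + 9), so ln N
      is controlled by \<open>K\<close>; the maximum exists because \<open>P k\<close> forces
      \<open>k \<le> N\<close>.\<close>
    define K where "K = Greatest P"
    have P1: "P 1" using False by (simp add: P_def)
    have bound: "k \<le> N" if "P k" for k
    proof -
      have "k < 2 ^ k" by simp
      also have "(2::nat) ^ k \<le> 2 ^ (2 * k + 7)" by (intro power_increasing) auto
      finally show ?thesis using that by (simp add: P_def)
    qed
    have PK: "P K"
      unfolding K_def by (rule GreatestI_nat[of P 1 N]) (use P1 bound in auto)
    have K1: "K \<ge> 1"
      unfolding K_def by (rule Greatest_le_nat[of P 1 N]) (use P1 bound in auto)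
    have "\<not> P (Suc K)"
      using Greatest_le_nat[of P "Suc K" N] bound by (auto simp: K_def)
    then have "N \<le> 2 ^ (2 * Suc K + 7)" by (simp add: P_def)
    \<comment> \<open>Here 2 K + 9 is at most 11 K because K is at least 1, and 11 / 2000 < 1 /
      8.\<close>
    from ln_le[OF this] have "1 / 2000 * ln (real N) \<le> real K / 8"
      using K1 by simp
    then show ?thesis
      using L2_operator_norm_maximal_hilbert_ge_scales[OF S K1] PK
      by (meson P_def ennreal_leI order_trans)
  qed
qed simp

end
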